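(* Let $n\ge1$ be an integer. The group $\mathrm{Isom}\,\mathbb{Z}^n$ (acting on $\mathbb{Z}^n$) is fixating.
   Context: $\mathbb{Z}^n$ is endowed with the distance induced by the Euclidean norm of $\mathbb{R}^n$, and $\mathrm{Isom}\,\mathbb{Z}^n$ is the group of its isometries (distance-preserving bijections $\mathbb{Z}^n\to\mathbb{Z}^n$). For a bijection $g$ of a set $X$, $\mathrm{Fix}\,g=\{x\in X: g(x)=x\}$. A group $H$ of bijections of $X$ is a GAF if $\mathrm{Fix}\,g\neq\emptyset$ for every $g\in H$; it is a GAG if $\bigcap_{g\in H}\mathrm{Fix}\,g\ne\emptyset$. A group $G$ of bijections of $X$ is fixating if every subgroup of $G$ that is a GAF is a GAG. *)

theory Defs
  imports "HOL-Analysis.Analysis" "HOL-Algebra.Bij"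
begin

text \<open>
  A group of bijections of \<open>X\<close> is a subgroup of the symmetric group \<^term>\<open>BijGroup X\<close>. Its
  elements take the dummy value \<^term>\<open>undefined\<close> outside \<open>X\<close>, so that they
  correspond exactly to the bijections from \<open>X\<close> to \<open>X\<close>.
\<close>

definition group_of_bijections :: "'a set \<Rightarrow> ('a \<Rightarrow> 'a) set \<Rightarrow> bool" where
  "group_of_bijections X G \<longleftrightarrow> subgroup G (BijGroup X)"

definition Fix :: "'a set \<Rightarrow> ('a \<Rightarrow> 'a) \<Rightarrow> 'a set" where
  "Fix X g = {x \<in> X. g x = x}"

definition GAF :: "'a set \<Rightarrow> ('a \<Rightarrow> 'a) set \<Rightarrow> bool" where
  "GAF X H \<longleftrightarrow> group_of_bijections X H \<and> (\<forall>g\<in>H. Fix X g \<noteq> {})"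

definition GAG :: "'a set \<Rightarrow> ('a \<Rightarrow> 'a) set \<Rightarrow> bool" where
  "GAG X H \<longleftrightarrow> group_of_bijections X H \<and> (\<Inter>g\<in>H. Fix X g) \<noteq> {}"

definition fixating :: "'a set \<Rightarrow> ('a \<Rightarrow> 'a) set \<Rightarrow> bool" where
  "fixating X G \<longleftrightarrow> group_of_bijections X G \<and>
     (\<forall>H. subgroup H ((BijGroup X)\<lparr>carrier := G\<rparr>) \<longrightarrow> GAF X H \<longrightarrow> GAG X H)"

definition Isom :: "'a::metric_space set \<Rightarrow> ('a \<Rightarrow> 'a) set" where
  "Isom X = {f \<in> Bij X. \<forall>x\<in>X. \<forall>y\<in>X. dist (f x) (f y) = dist x y}"

definition int_lattice :: "(real ^ 'n) set" where
  "int_lattice = {x. \<forall>i. x $ i \<in> \<int>}"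

end

theory Submission
  imports Defs
begin

text \<open>
  Let \<open>H\<close> be a group of isometries of the lattice each of whose elements fixes a lattice point.
  An isometry of the lattice is a signed permutation of the coordinates followed by an integral
  translation, so each coordinate of \<open>h x\<close> is \<open>\<phi> (x $ j)\<close> for some \<open>j\<close> and some isometry \<open>\<phi>\<close> of the
  integers (\<open>lattice_isometry_coord\<close>). A common fixed point can therefore be built coordinate by
  coordinate, in two steps.

  For a single coordinate \<open>k\<close>, the elements of \<open>H\<close> that send this coordinate to itself induce
  isometries of the integers, all with fixed points. Such an isometry is the identity or a
  reflection in an integer, and two different reflections cannot both occur, since their
  composition would be a translation without fixed points. Hence all of them fix a common integer
  (\<open>stable_value_exists\<close>): the centre of the reflection if there is one, any integer otherwise.

  The group permutes the coordinates. Choosing a representative \<open>k\<close> and a value \<open>v\<close> as above in each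
  orbit, the value \<open>v\<close> is transported to every other coordinate of the orbit by the isometry \<open>\<phi>\<close> of
  the integers that an element of \<open>H\<close> induces between the two. Two choices of that element
  differ by an element that sends \<open>k\<close> to itself, which leaves \<open>v\<close> unchanged, so the transported
  value is well defined (\<open>transport_unique\<close>), and the point with these coordinates is fixed
  by \<open>H\<close> (\<open>common_fixed_point\<close>).
\<close>

section \<open>Isometry groups of a metric space\<close>

lemma BijGroup_simps:
  "carrier (BijGroup X) = Bij X"
  "f \<in> Bij X \<Longrightarrow> g \<in> Bij X \<Longrightarrow> f \<otimes>\<^bsub>BijGroup X\<^esub> g = compose X f g"
  "\<one>\<^bsub>BijGroup X\<^esub> = (\<lambda>x\<in>X. x)"
  by (simp_all add: BijGroup_def)

lemma Bij_mem: "f \<in> Bij X \<Longrightarrow> x \<in> X \<Longrightarrow> f x \<in> X"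
  by (auto simp: Bij_def bij_betw_def)

lemma Bij_right_inverse:
  assumes "f \<in> Bij X" "x \<in> X"
  shows "inv_into X f x \<in> X" "f (inv_into X f x) = x"
  using assms by (auto simp: Bij_def bij_betw_def inv_into_into f_inv_into_f)

lemma subgroup_Isom: "subgroup (Isom X) (BijGroup X)"
proof (rule group.subgroupI[OF group_BijGroup])
  show "Isom X \<subseteq> carrier (BijGroup X)"
    by (auto simp: Isom_def BijGroup_simps)
  have "(\<lambda>x\<in>X. x) \<in> Isom X"
    by (auto simp: Isom_def id_Bij)
  then show "Isom X \<noteq> {}"
    by blast
next
  fix f assume f: "f \<in> Isom X"
  then have fB: "f \<in> Bij X"
    and d: "\<And>x y. x \<in> X \<Longrightarrow> y \<in> X \<Longrightarrow> dist (f x) (f y) = dist x y"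
    by (auto simp: Isom_def)
  have "dist (inv_into X f x) (inv_into X f y) = dist x y" if "x \<in> X" "y \<in> X" for x y
    using d[of "inv_into X f x" "inv_into X f y"] Bij_right_inverse[OF fB that(1)]
      Bij_right_inverse[OF fB that(2)] by simp
  then show "inv\<^bsub>BijGroup X\<^esub> f \<in> Isom X"
    using fB by (simp add: inv_BijGroup Isom_def restrict_inv_into_Bij)
next
  fix f g assume "f \<in> Isom X" "g \<in> Isom X"
  then show "f \<otimes>\<^bsub>BijGroup X\<^esub> g \<in> Isom X"
    by (auto simp: Isom_def BijGroup_simps compose_Bij compose_eq Bij_mem)
qed

section \<open>Isometries of the integer lattice\<close>

definition int_isometries :: "(real \<Rightarrow> real) set" where
  "int_isometries = {\<phi>. \<exists>s\<in>{1, -1}. \<exists>c\<in>\<int>. \<phi> = (\<lambda>t. s * t + c)}"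

lemma int_isometriesI: "s \<in> {1, -1} \<Longrightarrow> c \<in> \<int> \<Longrightarrow> (\<lambda>t. s * t + c) \<in> int_isometries"
  unfolding int_isometries_def by blast

lemma int_isometriesE:
  assumes "\<phi> \<in> int_isometries"
  obtains s c where "s \<in> {1, -1}" "c \<in> \<int>" "\<phi> = (\<lambda>t. s * t + c)"
  using assms unfolding int_isometries_def by blast

lemma int_isometries_comp:
  assumes "\<phi> \<in> int_isometries" "\<psi> \<in> int_isometries"
  shows "\<phi> \<circ> \<psi> \<in> int_isometries"
proof -
  obtain s c where 1: "s \<in> {1, -1::real}" "c \<in> \<int>" "\<phi> = (\<lambda>t. s * t + c)"
    using assms(1) by (rule int_isometriesE)
  obtain r d where 2: "r \<in> {1, -1::real}" "d \<in> \<int>" "\<psi> = (\<lambda>t. r * t + d)"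
    using assms(2) by (rule int_isometriesE)
  have "\<phi> \<circ> \<psi> = (\<lambda>t. (s * r) * t + (s * d + c))"
    by (simp add: 1(3) 2(3) fun_eq_iff algebra_simps)
  also have "\<dots> \<in> int_isometries"
    by (rule int_isometriesI) (use 1 2 in auto)
  finally show ?thesis .
qed

lemma int_isometries_inverse:
  assumes "\<phi> \<in> int_isometries"
  obtains \<psi> where "\<psi> \<in> int_isometries" "\<And>t. \<psi> (\<phi> t) = t" "\<And>t. \<phi> (\<psi> t) = t"
proof -
  obtain s c where 1: "s \<in> {1, -1::real}" "c \<in> \<int>" "\<phi> = (\<lambda>t. s * t + c)"
    using assms by (rule int_isometriesE)
  have "(\<lambda>t. s * t + (- s * c)) \<in> int_isometries"
    by (rule int_isometriesI) (use 1 in auto)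
  then show ?thesis
    by (rule that) (use 1 in \<open>auto simp: algebra_simps\<close>)
qed

lemma int_isometries_Ints: "\<phi> \<in> int_isometries \<Longrightarrow> t \<in> \<int> \<Longrightarrow> \<phi> t \<in> \<int>"
  by (auto simp: int_isometries_def)

lemma int_lattice_nth: "x \<in> int_lattice \<Longrightarrow> x $ i \<in> \<int>"
  by (simp add: int_lattice_def)

lemma axis_in_int_lattice: "axis i 1 \<in> int_lattice"
  by (simp add: int_lattice_def axis_def)

text \<open>
  The squares of the coordinates are 0 or at least 1 and have sum 1, so exactly one of them is
  nonzero.
\<close>
lemma int_lattice_unit_vector:
  fixes u :: "real ^ 'n::finite"
  assumes "u \<in> int_lattice" "norm u = 1"
  obtains j s where "s \<in> {1, -1}" "u = axis j s"
proof -
  have sum1: "(\<Sum>i\<in>UNIV. (u $ i)\<^sup>2) = 1"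
    using assms(2) norm_eq_1[of u] by (simp add: inner_vec_def power2_eq_square)
  have big: "1 \<le> (u $ i)\<^sup>2" if "u $ i \<noteq> 0" for i
    using Ints_nonzero_abs_ge1[OF int_lattice_nth[OF assms(1)] that]
    by (metis abs_ge_zero one_le_power power2_abs)
  obtain j where j: "u $ j \<noteq> 0"
    using sum1 by (metis (no_types, lifting) power_zero_numeral sum.neutral zero_neq_one)
  have split: "1 = (u $ j)\<^sup>2 + (\<Sum>i\<in>UNIV - {j}. (u $ i)\<^sup>2)"
    unfolding sum1[symmetric] by (rule sum.remove) auto
  have rest_nonneg: "0 \<le> (\<Sum>i\<in>UNIV - {j}. (u $ i)\<^sup>2)"
    by (rule sum_nonneg) simp
  have rest: "(\<Sum>i\<in>UNIV - {j}. (u $ i)\<^sup>2) = 0" and uj: "(u $ j)\<^sup>2 = 1"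
    using split rest_nonneg big[OF j] by linarith+
  have "u $ i = 0" if "i \<noteq> j" for i
    using rest that by (subst (asm) sum_nonneg_eq_0_iff) auto
  then have "u = axis j (u $ j)"
    by (auto simp: vec_eq_iff axis_def)
  moreover have "u $ j \<in> {1, -1}"
    using uj by (simp add: power2_eq_1_iff)
  ultimately show ?thesis
    using that by blast
qed

text \<open>
  After subtracting \<open>h 0\<close>, the isometry preserves inner products. If \<open>u\<close> is the preimage of the
  basis vector \<open>axis i 1\<close>, then the coordinate \<open>i\<close> of the image of \<open>x\<close> is the inner product
  of \<open>x\<close> with \<open>u\<close>, and \<open>u\<close> is a unit vector of the lattice.
\<close>
lemma lattice_isometry_coord:
  fixes h :: "real ^ 'n::finite \<Rightarrow> real ^ 'n"
  assumes "h \<in> Isom int_lattice"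
  obtains j \<phi> where "\<phi> \<in> int_isometries" "\<And>x. x \<in> int_lattice \<Longrightarrow> h x $ i = \<phi> (x $ j)"
proof -
  let ?L = "int_lattice :: (real ^ 'n) set"
  have hB: "h \<in> Bij ?L"
    and iso: "\<And>x y. x \<in> ?L \<Longrightarrow> y \<in> ?L \<Longrightarrow> dist (h x) (h y) = dist x y"
    using assms by (auto simp: Isom_def)
  have zero: "0 \<in> ?L"
    by (simp add: int_lattice_def)
  have h0: "h 0 \<in> ?L"
    using Bij_mem[OF hB zero] .
  define T where "T x = h x - h 0" for x
  have norm_T: "norm (T x) = norm x" if "x \<in> ?L" for x
    using iso[OF that zero] by (simp add: T_def dist_norm)
  have inner_T: "T x \<bullet> T y = x \<bullet> y" if "x \<in> ?L" "y \<in> ?L" for x y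
  proof -
    have "norm (T x - T y) = norm (x - y)"
      using iso[OF that] by (simp add: T_def dist_norm)
    then show ?thesis
      using norm_T that by (simp add: dot_norm_neg)
  qed
  have target: "axis i 1 + h 0 \<in> ?L"
    using h0 axis_in_int_lattice[of i] by (auto simp: int_lattice_def)
  obtain u where u: "u \<in> ?L" "T u = axis i 1"
    using Bij_right_inverse[OF hB target] by (auto simp: T_def)
  have "norm u = 1"
    using norm_T[OF u(1)] u(2) by simp
  then obtain j s where s: "s \<in> {1, -1}" "u = axis j s"
    using int_lattice_unit_vector[OF u(1)] by blast
  show ?thesis
  proof (rule that)
    show "(\<lambda>t. s * t + h 0 $ i) \<in> int_isometries"
      by (intro int_isometriesI s(1) int_lattice_nth h0)
  next
    fix x assume x: "x \<in> ?L"
    have "T x $ i = T x \<bullet> T u"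
      by (simp add: u(2) inner_axis)
    also have "\<dots> = s * x $ j"
      using inner_T[OF x u(1)] s(2) by (simp add: inner_axis)
    finally show "h x $ i = s * x $ j + h 0 $ i"
      by (simp add: T_def)
  qed
qed

section \<open>Groups of lattice isometries all of whose elements have fixed points\<close>

locale lattice_GAF =
  fixes H :: "(real ^ 'n::finite \<Rightarrow> real ^ 'n) set"
  assumes subgroup_H: "subgroup H (BijGroup int_lattice)"
    and H_Isom: "H \<subseteq> Isom int_lattice"
    and H_Fix: "\<And>h. h \<in> H \<Longrightarrow> Fix int_lattice h \<noteq> {}"
begin

lemma H_Bij: "h \<in> H \<Longrightarrow> h \<in> Bij int_lattice"
  using H_Isom by (auto simp: Isom_def)

lemma H_mem: "h \<in> H \<Longrightarrow> x \<in> int_lattice \<Longrightarrow> h x \<in> int_lattice"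
  by (rule Bij_mem[OF H_Bij])

lemma H_id: "(\<lambda>x\<in>int_lattice. x) \<in> H"
  using subgroup.one_closed[OF subgroup_H] by (simp add: BijGroup_simps)

lemma H_comp:
  assumes "g \<in> H" "h \<in> H"
  obtains k where "k \<in> H" "\<And>x. x \<in> int_lattice \<Longrightarrow> k x = g (h x)"
proof (rule that)
  show "compose int_lattice g h \<in> H"
    using subgroup.m_closed[OF subgroup_H assms] assms by (simp add: BijGroup_simps H_Bij)
qed (rule compose_eq)

lemma H_inverse:
  assumes "g \<in> H"
  obtains k where "k \<in> H" "\<And>x. x \<in> int_lattice \<Longrightarrow> g (k x) = x"
proof (rule that)
  show "restrict (inv_into int_lattice g) int_lattice \<in> H"
    using subgroup.m_inv_closed[OF subgroup_H assms] assms by (simp add: inv_BijGroup H_Bij)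
qed (use assms in \<open>simp add: H_Bij Bij_right_inverse\<close>)

definition induces :: "(real ^ 'n \<Rightarrow> real ^ 'n) \<Rightarrow> 'n \<Rightarrow> 'n \<Rightarrow> (real \<Rightarrow> real) \<Rightarrow> bool" where
  "induces h i j \<phi> \<longleftrightarrow>
     h \<in> H \<and> \<phi> \<in> int_isometries \<and> (\<forall>x\<in>int_lattice. h x $ i = \<phi> (x $ j))"

lemma induces_exists:
  assumes "h \<in> H"
  obtains j \<phi> where "induces h i j \<phi>"
proof -
  obtain j \<phi> where "\<phi> \<in> int_isometries" "\<And>x. x \<in> int_lattice \<Longrightarrow> h x $ i = \<phi> (x $ j)"
    by (rule lattice_isometry_coord[of h i]) (use H_Isom assms in auto)
  then have "induces h i j \<phi>"
    using assms by (simp add: induces_def)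
  then show ?thesis
    by (rule that)
qed

lemma induces_refl: "\<exists>h \<phi>. induces h i i \<phi>"
proof -
  have "id \<in> int_isometries"
    using int_isometriesI[of 1 0] by (simp add: id_def)
  then show ?thesis
    using H_id by (force simp: induces_def)
qed

lemma induces_comp:
  assumes "induces g i j \<phi>" "induces h j k \<psi>"
  obtains f where "induces f i k (\<phi> \<circ> \<psi>)"
proof -
  obtain f where "f \<in> H" "\<And>x. x \<in> int_lattice \<Longrightarrow> f x = g (h x)"
    using H_comp assms unfolding induces_def by metis
  then have "induces f i k (\<phi> \<circ> \<psi>)"
    using assms by (auto simp: induces_def int_isometries_comp H_mem)
  then show ?thesis
    by (rule that)
qed

lemma induces_inverse:
  assumes "induces g i j \<phi>"
  obtains f \<psi> where "induces f j i \<psi>" "\<And>t. \<psi> (\<phi> t) = t" "\<And>t. \<phi> (\<psi> t) = t"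
proof -
  obtain f where f: "f \<in> H" "\<And>x. x \<in> int_lattice \<Longrightarrow> g (f x) = x"
    using H_inverse assms unfolding induces_def by metis
  obtain \<psi> where psi: "\<psi> \<in> int_isometries" "\<And>t. \<psi> (\<phi> t) = t" "\<And>t. \<phi> (\<psi> t) = t"
    using int_isometries_inverse assms unfolding induces_def by metis
  have "f x $ j = \<psi> (x $ i)" if "x \<in> int_lattice" for x
  proof -
    have "x $ i = \<phi> (f x $ j)"
      using assms f that H_mem unfolding induces_def by metis
    then show ?thesis
      by (simp add: psi)
  qed
  then have "induces f j i \<psi>"
    using f psi by (simp add: induces_def)
  then show ?thesis
    using that psi by blast
qed

lemma induces_self_fixed:
  assumes "induces h k k \<phi>"
  obtains a where "a \<in> \<int>" "\<phi> a = a"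
proof -
  obtain q where "q \<in> int_lattice" "h q = q"
    using H_Fix[of h] assms by (auto simp: induces_def Fix_def)
  then show ?thesis
    using assms that[of "q $ k"] int_lattice_nth by (metis induces_def)
qed

text \<open>
  Isometries of the integers with fixed points are the identity and the reflections in integers.
  If a reflection occurs, its centre is the only candidate, and it works because composing two
  reflections in different points gives a translation without fixed points.
\<close>
lemma stable_value_exists:
  "\<exists>v\<in>\<int>. \<forall>h \<phi>. induces h k k \<phi> \<longrightarrow> \<phi> v = v"
proof (cases "\<exists>h c. induces h k k (\<lambda>t. - t + c)")
  case False
  have "\<phi> 0 = 0" if ind: "induces h k k \<phi>" for h \<phi>
  proof -
    obtain s c where sc: "s \<in> {1, -1::real}" "\<phi> = (\<lambda>t. s * t + c)"
      using ind int_isometriesE[of \<phi>] unfolding induces_def by metis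
    have "s = 1"
      using False ind sc by auto
    then show ?thesis
      using induces_self_fixed[OF ind] sc by auto
  qed
  then show ?thesis
    by (intro bexI[of _ 0]) auto
next
  case True
  then obtain g c where g: "induces g k k (\<lambda>t. - t + c)"
    by blast
  obtain a where a: "a \<in> \<int>" "- a + c = a"
    using induces_self_fixed[OF g] by auto
  have "\<phi> a = a" if ind: "induces h k k \<phi>" for h \<phi>
  proof -
    obtain s d where sd: "s \<in> {1, -1::real}" "\<phi> = (\<lambda>t. s * t + d)"
      using ind int_isometriesE[of \<phi>] unfolding induces_def by metis
    \<comment> \<open>Either \<open>\<phi>\<close> or its composition with the reflection \<open>\<lambda>t. - t + c\<close> is a translation; having
      a fixed point, that one is the identity. In both cases \<open>\<phi>\<close> fixes the centre \<open>a\<close>.\<close>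
    obtain f where f: "induces f k k ((\<lambda>t. - t + c) \<circ> \<phi>)"
      using induces_comp[OF g ind] by blast
    show ?thesis
      using sd(1) induces_self_fixed[OF ind] induces_self_fixed[OF f] a(2)
      unfolding sd(2) by fastforce
  qed
  then show ?thesis
    using a(1) by blast
qed

text \<open>
  The isometries \<open>\<phi>\<close> and \<open>\<psi>\<close> differ by an isometry induced by an element that sends the
  coordinate \<open>k\<close> to itself, and \<open>v\<close> is stable under those.
\<close>
lemma transport_unique:
  assumes "induces g i k \<phi>" "induces h i k \<psi>"
    and stable: "\<And>f \<theta>. induces f k k \<theta> \<Longrightarrow> \<theta> v = v"
  shows "\<phi> v = \<psi> v"
proof -
  obtain g' \<phi>' where inv: "induces g' k i \<phi>'" "\<And>t. \<phi> (\<phi>' t) = t"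
    using induces_inverse[OF assms(1)] by metis
  obtain f where "induces f k k (\<phi>' \<circ> \<psi>)"
    using induces_comp[OF inv(1) assms(2)] by blast
  then have "\<phi>' (\<psi> v) = v"
    using stable by fastforce
  then show ?thesis
    using inv(2) by metis
qed

lemma common_fixed_point: "\<exists>p\<in>int_lattice. \<forall>g\<in>H. g p = p"
proof -
  \<comment> \<open>The orbit relation on coordinates.\<close>
  define R where "R i j \<longleftrightarrow> (\<exists>h \<phi>. induces h i j \<phi>)" for i j
  have R_refl: "R i i" for i
    using induces_refl by (simp add: R_def)
  have R_sym: "R j i" if "R i j" for i j
    using that induces_inverse unfolding R_def by metis
  have R_trans: "R i k" if "R i j" "R j k" for i j k
    using that induces_comp unfolding R_def by metis
  define rep where "rep i = (SOME k. R i k)" for i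
  have R_rep: "R i (rep i)" for i
    unfolding rep_def by (rule someI, rule R_refl)
  have rep_eq: "rep i = rep j" if "R i j" for i j
  proof -
    have "R i = R j"
      using that R_sym R_trans by blast
    then show ?thesis
      by (simp add: rep_def)
  qed
  obtain v where v_Ints: "\<And>k. v k \<in> \<int>"
    and v_stable: "\<And>k h \<phi>. induces h k k \<phi> \<Longrightarrow> \<phi> (v k) = v k"
    using stable_value_exists by metis
  obtain h \<phi> where via: "\<And>i. induces (h i) i (rep i) (\<phi> i)"
    using R_rep unfolding R_def by metis
  define p where "p = (\<chi> i. \<phi> i (v (rep i)))"
  have p: "p \<in> int_lattice"
    using via v_Ints by (auto simp: p_def int_lattice_def induces_def int_isometries_Ints)
  have "g p = p" if g: "g \<in> H" for g
  proof -
    have "g p $ i = p $ i" for i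
    proof -
      obtain j \<theta> where ind: "induces g i j \<theta>"
        using induces_exists[OF g] by blast
      then have same: "rep i = rep j"
        using rep_eq R_def by blast
      \<comment> \<open>Both \<open>\<phi> i\<close> and \<open>\<theta> \<circ> \<phi> j\<close> transport from the representative to \<open>i\<close>.\<close>
      obtain f where "induces f i (rep i) (\<theta> \<circ> \<phi> j)"
        using induces_comp[OF ind via[of j]] same by metis
      then have "\<phi> i (v (rep i)) = (\<theta> \<circ> \<phi> j) (v (rep i))"
        using transport_unique[OF via[of i]] v_stable by blast
      then show ?thesis
        using ind p by (simp add: induces_def p_def same)
    qed
    then show ?thesis
      by (simp add: vec_eq_iff)
  qed
  with p show ?thesis
    by blast
qed

end

theorem theorem6p2:
  shows "fixating (int_lattice :: (real ^ 'n::finite) set) (Isom int_lattice)"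
  unfolding fixating_def
proof (intro conjI allI impI)
  show "group_of_bijections (int_lattice :: (real ^ 'n) set) (Isom int_lattice)"
    by (simp add: group_of_bijections_def subgroup_Isom)
next
  fix H :: "(real ^ 'n \<Rightarrow> real ^ 'n) set"
  assume sub: "subgroup H ((BijGroup int_lattice)\<lparr>carrier := Isom int_lattice\<rparr>)"
    and gaf: "GAF int_lattice H"
  interpret lattice_GAF H
  proof (rule lattice_GAF.intro)
    show "H \<subseteq> Isom int_lattice"
      using subgroup.subset[OF sub] by simp
  qed (use gaf in \<open>auto simp: GAF_def group_of_bijections_def\<close>)
  show "GAG int_lattice H"
    using common_fixed_point gaf by (auto simp: GAG_def GAF_def Fix_def)
qed

end
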